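(* Let $q\ge 2$ and $c\ge 1$ be integers and let $\kappa>0$. Consider a (symmetric) colluder strategy with parametrization $\Psi_b(\vec{x})$ that belongs to Class 1, i.e. there are real-valued functions $w$ and $W$ such that for every $b\in\{1,\dots,c\}$ and every $\vec{x}\in\mathbb{N}^{q-1}$ with $\sum_\beta x_\beta=c-b$, $$\Psi_b(\vec{x})=w(b,\ell)\prod_{k=1}^{r}W(b,\ell,z_k),$$ where $\ell$ is the number of entries of $\vec{x}$ equal to $b$, $r=q-1-\ell$, and $z_1,\dots,z_r$ are the entries of $\vec{x}$ different from $b$. Let $b\in\{1,\dots,c\}$, and let $N_b\in\mathbb{N}$ satisfy $N_b>\max\{c-b,\;|c-bq|,\;(c-b)(q-2)\}$. Let $\tau_b= e^{i2\pi/N_b}$, and for integers $a\in\{0,\dots,N_b-1\}$ and $\ell\in\{0,\dots,q-1\}$ let $$G_{ba\ell}=\sum_{z\in\{0,\ldots,c-b\}\setminus\{b\}}\frac{\Gamma(\kappa+z)\,W(b,\ell,z)}{\tau_b^{az}\,z!},\qquad v_{ba}=\frac{\Gamma(\kappa+b)}{\tau_b^{ab}\,b!}.$$ Then $$K_b=\frac{(c-b)!}{N_b\,\Gamma(c-b+\kappa[q-1])\,B(\kappa\mathbf{1}_{q-1})}\sum_{a=0}^{N_b-1}\tau_b^{a(c-b)}\sum_{\ell=0}^{q-1}\binom{q-1}{\ell}G_{ba\ell}^{\,q-1-\ell}\,w(b,\ell)\,v_{ba}^{\,\ell}.$$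
   Context: $\mathbb{N}$ includes $0$. $\mathcal{Q}$ is an alphabet of size $q$, $c$ is the number of colluders, $\kappa>0$ is a constant. $\mathbf{1}_n=(1,\dots,1)$ has length $n$. For a vector $\vec{v}$ with $n\ge1$ positive entries the generalized Beta function is $B(\vec{v})=\prod_{a=1}^n\Gamma(v_a)\big/\Gamma\big(\sum_{a=1}^n v_a\big)$. For $\vec{x}\in\mathbb{N}^{q-1}$ with entries summing to $c-b$, $\binom{c-b}{\vec{x}}=(c-b)!/\prod_\beta x_\beta!$ is the multinomial coefficient. A colluder strategy is given by probabilities $\theta_{y|\vec{\sigma}}$ (with $\sum_{y\in\mathcal{Q}}\theta_{y|\vec\sigma}=1$) that the colluders output symbol $y\in\mathcal{Q}$, given the vector $\vec{\sigma}\in\mathbb{N}^{q}$ with $\sum_\alpha\sigma_\alpha=c$, where $\sigma_\alpha$ counts the colluders that received symbol $\alpha$; colluders can only output a symbol they received, i.e. $\theta_{y|\vec\sigma}=0$ if $\sigma_y=0$. The strategy is symbol-symmetric: $\theta_{\alpha|\vec\sigma}$ depends on $\alpha$ only through the value $\sigma_\alpha$, and is invariant under permutation of the other components of $\vec\sigma$. Hence one can define $\Psi_b(\vec{x})=\theta_{\alpha|\vec{\sigma}}$ where $\sigma_\alpha=b$ and $\vec{x}\in\mathbb{N}^{q-1}$ consists of the other components of $\vec\sigma$ (so the entries of $\vec{x}$ sum to $c-b$). The parameters $K_b$ are defined as $$K_b=\sum_{\vec{x}}\mathbb{P}_{q-1}(\vec{x}|b)\,\Psi_b(\vec{x}),\qquad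 \mathbb{P}_{q-1}(\vec{x}|b)=\binom{c-b}{\vec{x}}\frac{B(\kappa\mathbf{1}_{q-1}+\vec{x})}{B(\kappa\mathbf{1}_{q-1})},$$ where the sum is over all $\vec{x}\in\mathbb{N}^{q-1}$ whose entries sum to $c-b$. The functions $w(b,\ell)$ and $W(b,\ell,z)$ are taken to be defined for all $\ell\in\{0,\dots,q-1\}$ and all $z\in\{0,\dots,c-b\}\setminus\{b\}$. Powers with exponent $0$ equal $1$ (including $0^0=1$). *)

theory Defs
  imports "HOL-Analysis.Analysis" "HOL-Library.Multiset"
begin

text \<open>
  The alphabet is the finite type \<open>'s\<close>, and \<open>\<theta> y \<sigma>\<close> is the probability that the colluders output
  \<open>y\<close> when \<open>\<sigma> \<alpha>\<close> of them have received the symbol \<open>\<alpha>\<close>. A vector in \<open>\<nat>\<^sup>q\<^sup>-\<^sup>1\<close> is a list of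
  length \<open>q - 1\<close>.
\<close>

definition symbol_counts :: "nat \<Rightarrow> ('s::finite \<Rightarrow> nat) set" where
  "symbol_counts c = {\<sigma>. (\<Sum>\<alpha>\<in>UNIV. \<sigma> \<alpha>) = c}"

definition colluder_strategy :: "nat \<Rightarrow> ('s::finite \<Rightarrow> ('s \<Rightarrow> nat) \<Rightarrow> real) \<Rightarrow> bool" where
  "colluder_strategy c \<theta> \<longleftrightarrow>
     (\<forall>\<sigma>\<in>symbol_counts c.
        (\<forall>y. 0 \<le> \<theta> y \<sigma>) \<and> (\<Sum>y\<in>UNIV. \<theta> y \<sigma>) = 1 \<and> (\<forall>y. \<sigma> y = 0 \<longrightarrow> \<theta> y \<sigma> = 0))"

definition other_components :: "('s::finite \<Rightarrow> nat) \<Rightarrow> 's \<Rightarrow> nat multiset" where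
  "other_components \<sigma> \<alpha> = image_mset \<sigma> (mset_set (UNIV - {\<alpha>}))"

text \<open>
  The value \<open>\<theta> \<alpha> \<sigma>\<close> is determined by \<open>\<sigma> \<alpha>\<close> and by the other components up to order. The two sides
  may have different symbols and different count vectors; this is what makes \<open>\<Psi>\<close> well defined.
\<close>

definition symbol_symmetric :: "nat \<Rightarrow> ('s::finite \<Rightarrow> ('s \<Rightarrow> nat) \<Rightarrow> real) \<Rightarrow> bool" where
  "symbol_symmetric c \<theta> \<longleftrightarrow>
     (\<forall>\<sigma>\<in>symbol_counts c. \<forall>\<sigma>'\<in>symbol_counts c. \<forall>\<alpha> \<alpha>'.
        \<sigma> \<alpha> = \<sigma>' \<alpha>' \<and> other_components \<sigma> \<alpha> = other_components \<sigma>' \<alpha>' \<longrightarrow> \<theta> \<alpha> \<sigma> = \<theta> \<alpha>' \<sigma>')"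

definition Psi :: "('s::finite \<Rightarrow> ('s \<Rightarrow> nat) \<Rightarrow> real) \<Rightarrow> nat \<Rightarrow> nat list \<Rightarrow> real" where
  "Psi \<theta> b x = (THE p. \<exists>\<alpha> \<sigma>. \<sigma> \<alpha> = b \<and> other_components \<sigma> \<alpha> = mset x \<and> p = \<theta> \<alpha> \<sigma>)"

lemma symbol_counts_iff:
  "\<sigma> \<in> symbol_counts c \<longleftrightarrow> \<sigma> \<alpha> + sum_mset (other_components \<sigma> \<alpha>) = c"
  by (simp add: symbol_counts_def other_components_def sum_unfold_sum_mset[symmetric]
      sum.remove[of UNIV \<alpha>])

lemma Psi_eq:
  assumes "symbol_symmetric c \<theta>" "\<sigma> \<in> symbol_counts c" "other_components \<sigma> \<alpha> = mset x"
  shows "Psi \<theta> (\<sigma> \<alpha>) x = \<theta> \<alpha> \<sigma>"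
proof -
  have "\<theta> \<alpha>' \<sigma>' = \<theta> \<alpha> \<sigma>" if "\<sigma>' \<alpha>' = \<sigma> \<alpha>" "other_components \<sigma>' \<alpha>' = mset x" for \<alpha>' \<sigma>'
  proof -
    have "\<sigma>' \<in> symbol_counts c"
      using that assms(2,3) symbol_counts_iff[of \<sigma> c \<alpha>] symbol_counts_iff[of \<sigma>' c \<alpha>'] by simp
    then show ?thesis
      using that assms unfolding symbol_symmetric_def by metis
  qed
  then show ?thesis
    unfolding Psi_def using assms(3) by (intro the_equality) blast+
qed

definition vectors :: "nat \<Rightarrow> nat \<Rightarrow> nat list set" where
  "vectors n s = {x. length x = n \<and> sum_list x = s}"

definition class1 ::
  "nat \<Rightarrow> nat \<Rightarrow> (nat \<Rightarrow> nat list \<Rightarrow> real) \<Rightarrow> (nat \<Rightarrow> nat \<Rightarrow> real) \<Rightarrow> (nat \<Rightarrow> nat \<Rightarrow> nat \<Rightarrow> real) \<Rightarrow> bool"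
where
  "class1 q c \<Psi> w W \<longleftrightarrow>
     (\<forall>b\<in>{1..c}. \<forall>x\<in>vectors (q - 1) (c - b).
        let l = count_list x b; zs = filter (\<lambda>z. z \<noteq> b) x; r = q - 1 - l
        in \<Psi> b x = w b l * (\<Prod>k<r. W b l (zs ! k)))"

definition gen_Beta :: "real list \<Rightarrow> real" where
  "gen_Beta v = prod_list (map Gamma v) / Gamma (sum_list v)"

definition multinomial :: "nat \<Rightarrow> nat list \<Rightarrow> real" where
  "multinomial n x = fact n / prod_list (map fact x)"

definition vec_prob :: "nat \<Rightarrow> nat \<Rightarrow> real \<Rightarrow> nat \<Rightarrow> nat list \<Rightarrow> real" where
  "vec_prob q c \<kappa> b x =
     multinomial (c - b) x * (gen_Beta (map (\<lambda>n. \<kappa> + real n) x) / gen_Beta (replicate (q - 1) \<kappa>))"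

definition K :: "nat \<Rightarrow> nat \<Rightarrow> real \<Rightarrow> (nat \<Rightarrow> nat list \<Rightarrow> real) \<Rightarrow> nat \<Rightarrow> real" where
  "K q c \<kappa> \<Psi> b = (\<Sum>x\<in>vectors (q - 1) (c - b). vec_prob q c \<kappa> b x * \<Psi> b x)"

definition tau :: "nat \<Rightarrow> complex" where
  "tau N = exp (\<i> * 2 * complex_of_real pi / of_nat N)"

definition G :: "nat \<Rightarrow> real \<Rightarrow> (nat \<Rightarrow> nat \<Rightarrow> nat \<Rightarrow> real) \<Rightarrow> nat \<Rightarrow> nat \<Rightarrow> nat \<Rightarrow> nat \<Rightarrow> complex" where
  "G c \<kappa> W N b a l =
     (\<Sum>z\<in>{0..c - b} - {b}.
        complex_of_real (Gamma (\<kappa> + real z) * W b l z) / (tau N ^ (a * z) * fact z))"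

definition v :: "real \<Rightarrow> nat \<Rightarrow> nat \<Rightarrow> nat \<Rightarrow> complex" where
  "v \<kappa> N b a = complex_of_real (Gamma (\<kappa> + real b)) / (tau N ^ (a * b) * fact b)"

end

theory Submission
  imports Defs
begin

text \<open>
  Put \<open>n = q - 1\<close>, \<open>s = c - b\<close>. The power \<open>tau N ^ (a * s)\<close> together with the powers in \<open>G\<close> and \<open>v\<close>
  is a discrete Fourier transform that imposes the constraint \<open>sum_list x = s\<close>. By a binomial
  expansion, the summand for \<open>l\<close> is a sum over the unconstrained vectors \<open>x\<close> of length \<open>n\<close> with
  entries in \<open>{0..s} \<union> {b}\<close>, exactly \<open>l\<close> of which equal \<open>b\<close>. The sum over \<open>a\<close> then gives \<open>N\<close> if
  \<open>sum_list x = s\<close> and \<open>0\<close> otherwise: the lower bound on \<open>N\<close> makes \<open>\<bar>s - sum_list x\<bar> < N\<close> for all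
  these \<open>x\<close>, which excludes aliasing.
\<close>

text \<open>Choosing the \<open>l\<close> positions of \<open>b\<close> gives the binomial
  coefficient, and the other \<open>n - l\<close> positions range independently over
  \<open>A - {b}\<close>. The induction removes the head of the list and ends in Pascal's
  rule.\<close>

lemma sum_lists_count_eq:
  fixes h :: "'a \<Rightarrow> 'b::comm_semiring_1"
  assumes "finite A" "b \<in> A"
  shows "(\<Sum>x | set x \<subseteq> A \<and> length x = n \<and> count_list x b = l. prod_list (map h x)) =
    of_nat (n choose l) * sum h (A - {b}) ^ (n - l) * h b ^ l"
proof (induction n arbitrary: l)
  case 0
  have "{x. set x \<subseteq> A \<and> length x = 0 \<and> count_list x b = l} = (if l = 0 then {[]} else {})"
    by auto
  then show ?case by (simp only:) (auto simp: binomial_eq_0)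
next
  case (Suc n)
  define L where "L m j = {x. set x \<subseteq> A \<and> length x = m \<and> count_list x b = j}" for m j
  define T where "T m j = (\<Sum>x\<in>L m j. prod_list (map h x))" for m j
  have fin: "finite (L m j)" for m j
    by (rule finite_subset[OF _ finite_lists_length_eq[OF assms(1), of m]]) (auto simp: L_def)
  have cons: "(\<Sum>x\<in>(#) z ` X. prod_list (map h x)) = h z * (\<Sum>x\<in>X. prod_list (map h x))" for z X
    by (simp add: sum.reindex sum_distrib_left)
  \<comment> \<open>The lists with a head other than \<open>b\<close>. Their tails keep the count
    \<open>l\<close>, while a head \<open>b\<close> leaves a tail with count \<open>l - 1\<close>;
    for \<open>l = 0\<close> only \<open>R\<close> remains.\<close>
  define R where "R = (\<Union>z\<in>A - {b}. (#) z ` L n l)"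
  have R: "(\<Sum>x\<in>R. prod_list (map h x)) = sum h (A - {b}) * T n l"
    unfolding R_def using assms(1) fin
    by (subst sum.UNION_disjoint) (auto simp: cons T_def sum_distrib_right)
  have IH: "T n j = of_nat (n choose j) * sum h (A - {b}) ^ (n - j) * h b ^ j" for j
    using Suc.IH[of j] by (simp add: T_def L_def)
  show ?case
  proof (cases l)
    case 0
    have "L (Suc n) l = R"
      unfolding L_def R_def 0 by (auto simp: length_Suc_conv image_iff split: if_splits)
    then have "T (Suc n) l = sum h (A - {b}) * T n l"
      using R by (simp add: T_def)
    then show ?thesis
      unfolding IH using 0 by (simp add: T_def L_def)
  next
    case (Suc j)
    have "L (Suc n) l = (#) b ` L n j \<union> R"
      unfolding L_def R_def Suc using assms(2)
      by (auto simp: length_Suc_conv image_iff split: if_splits)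
    moreover have "finite R" "(#) b ` L n j \<inter> R = {}"
      using assms(1) fin by (auto simp: R_def)
    ultimately have "T (Suc n) l = h b * T n j + sum h (A - {b}) * T n l"
      using R fin cons[of b "L n j"] by (simp add: T_def sum.union_disjoint)
    \<comment> \<open>Pascal's rule. For \<open>l > n\<close> the truncated exponents no longer
      satisfy \<open>n - j = Suc (n - l)\<close>, but then \<open>n choose l = 0\<close> removes the
      second term.\<close>
    also have "\<dots> = of_nat (Suc n choose l) * sum h (A - {b}) ^ (Suc n - l) * h b ^ l"
    proof (cases "l \<le> n")
      case True
      then have "n - j = Suc (n - l)" using Suc by simp
      then show ?thesis unfolding IH using Suc by (simp add: algebra_simps)
    next
      case False
      then show ?thesis unfolding IH using Suc by (simp add: algebra_simps binomial_eq_0)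
    qed
    finally show ?thesis by (simp add: T_def L_def)
  qed
qed

lemma tau_nonzero [simp]: "tau N \<noteq> 0"
  by (simp add: tau_def)

lemma tau_power: "tau N ^ j = exp (2 * of_real pi * \<i> * of_nat j / of_nat N)"
  by (simp add: tau_def exp_of_nat_mult [symmetric] mult_ac)

lemma tau_power_eq_iff:
  assumes "N > 0"
  shows "tau N ^ j = tau N ^ k \<longleftrightarrow> j mod N = k mod N"
  using complex_root_unity_eq[of N j k] assms by (simp add: tau_power cong_def)

text \<open>The sum is geometric with an \<open>N\<close>-th root of unity as its ratio, so it
  vanishes unless that ratio is 1. The hypotheses force \<open>\<bar>t - s\<bar> < N\<close> as
  integers, so \<open>t\<close> and \<open>s\<close> are congruent modulo \<open>N\<close> only if
  they are equal.\<close>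

lemma sum_tau_powers:
  assumes "s < N" "t < s + N"
  shows "(\<Sum>a<N. tau N ^ (a * s) / tau N ^ (a * t)) = (if t = s then of_nat N else 0)"
proof -
  define u where "u = tau N ^ s / tau N ^ t"
  have eq: "(\<Sum>a<N. tau N ^ (a * s) / tau N ^ (a * t)) = (\<Sum>a<N. u ^ a)"
    by (simp add: u_def power_divide power_mult [symmetric] mult.commute)
  have "tau N ^ N = 1"
    using tau_power_eq_iff[of N N 0] assms by simp
  then have uN: "u ^ N = 1"
    by (simp add: u_def power_divide power_mult [symmetric] mult.commute[of _ N])
      (simp add: power_mult)
  show ?thesis
  proof (cases "t = s")
    case True
    then show ?thesis by simp
  next
    case False
    have "t mod N \<noteq> s"
    proof (cases "t < N")
      case False
      then have "t mod N = (t - N) mod N" by (simp add: le_mod_geq)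
      also have "\<dots> \<le> t - N" by simp
      also have "\<dots> < s" using False assms by simp
      finally show ?thesis by simp
    qed (use \<open>t \<noteq> s\<close> in simp)
    then have "u \<noteq> 1"
      using tau_power_eq_iff[of N s t] assms by (auto simp: u_def)
    then have "(\<Sum>a<N. u ^ a) = 0"
      using uN by (simp add: geometric_sum)
    then show ?thesis using False eq by simp
  qed
qed

lemma prod_list_map_filter:
  fixes f :: "'a \<Rightarrow> 'b::comm_monoid_mult"
  shows "prod_list (map f (filter P x)) = prod_list (map (\<lambda>z. if P z then f z else 1) x)"
  by (induction x) auto

lemma prod_list_map_divide:
  fixes f g :: "'a \<Rightarrow> 'b::field"
  shows "prod_list (map (\<lambda>z. f z / g z) x) = prod_list (map f x) / prod_list (map g x)"
  by (induction x) auto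

lemma prod_list_map_mult:
  fixes f g :: "'a \<Rightarrow> 'b::comm_monoid_mult"
  shows "prod_list (map (\<lambda>z. f z * g z) x) = prod_list (map f x) * prod_list (map g x)"
  by (induction x) (auto simp: mult_ac)

lemma prod_list_of_real:
  "prod_list (map (\<lambda>z. of_real (f z)) x) =
    (of_real (prod_list (map f x)) :: 'a::{real_algebra_1,comm_ring_1})"
  by (induction x) auto

lemma prod_list_power_mult:
  fixes y :: "'a::comm_monoid_mult"
  shows "prod_list (map (\<lambda>z. y ^ (a * z)) x) = y ^ (a * sum_list x)"
  by (induction x) (auto simp: power_add distrib_left)

lemma sum_list_map_const_add:
  "sum_list (map (\<lambda>n. \<kappa> + real n) x) = real (length x) * \<kappa> + real (sum_list x)"
  by (induction x) (auto simp: algebra_simps)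

text \<open>As \<open>x\<close> has length \<open>q - 1\<close>, the \<open>r\<close> in
  \<open>class1\<close> is exactly the number of entries different from \<open>b\<close>. Giving the
  entries equal to \<open>b\<close> the factor 1 turns the product into one over all of
  \<open>x\<close>, which can be merged entrywise with the Gamma factors of
  \<open>vec_prob\<close>.\<close>

lemma class1D:
  assumes "class1 q c \<Psi> w W" "b \<in> {1..c}" "x \<in> vectors (q - 1) (c - b)"
  shows "\<Psi> b x = w b (count_list x b) *
    prod_list (map (\<lambda>z. if z = b then 1 else W b (count_list x b) z) x)"
proof -
  have len: "q - 1 - count_list x b = length (filter (\<lambda>z. z \<noteq> b) x)"
    using assms(3) sum_length_filter_compl[of "(=) b" x]
    by (auto simp: vectors_def count_list_eq_length_filter eq_commute[of b])
  have "(\<Prod>k<length zs. f (zs ! k)) = prod_list (map f zs)" for f :: "nat \<Rightarrow> real" and zs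
    by (simp add: prod.list_conv_set_nth atLeast0LessThan)
  moreover have "(\<lambda>z. if z \<noteq> b then W b l z else 1) = (\<lambda>z. if z = b then 1 else W b l z)" for l
    by auto
  moreover have "\<Psi> b x = w b (count_list x b) * (\<Prod>k<q - 1 - count_list x b.
      W b (count_list x b) (filter (\<lambda>z. z \<noteq> b) x ! k))"
    using assms unfolding class1_def Let_def by blast
  ultimately show ?thesis
    by (simp only: len prod_list_map_filter)
qed

text \<open>The denominator of the Beta function depends only on the length and the sum of
  \<open>x\<close>, both fixed on \<open>vectors\<close>. What depends on \<open>x\<close> itself
  splits into one factor per entry.\<close>

lemma vec_prob_eq:
  assumes "x \<in> vectors (q - 1) (c - b)"
  shows "vec_prob q c \<kappa> b x =
    fact (c - b) / (Gamma (real (c - b) + \<kappa> * real (q - 1)) * gen_Beta (replicate (q - 1) \<kappa>)) *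
    prod_list (map (\<lambda>z. Gamma (\<kappa> + real z) / fact z) x)"
proof -
  have "gen_Beta (map (\<lambda>n. \<kappa> + real n) x) =
      prod_list (map (\<lambda>z. Gamma (\<kappa> + real z)) x) / Gamma (real (c - b) + \<kappa> * real (q - 1))"
    using assms
    by (simp add: gen_Beta_def vectors_def sum_list_map_const_add comp_def algebra_simps)
  moreover have "multinomial (c - b) x = fact (c - b) / prod_list (map fact x)"
    by (simp add: multinomial_def of_nat_fact)
  ultimately show ?thesis
    by (simp add: vec_prob_def prod_list_map_divide mult_ac)
qed

theorem theorem1:
  fixes q c b N :: nat and \<kappa> :: real
    and \<theta> :: "'s::finite \<Rightarrow> ('s \<Rightarrow> nat) \<Rightarrow> real"
    and w :: "nat \<Rightarrow> nat \<Rightarrow> real" and W :: "nat \<Rightarrow> nat \<Rightarrow> nat \<Rightarrow> real"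
  assumes "CARD('s) = q" and "q \<ge> 2" and "c \<ge> 1" and "\<kappa> > 0"
    and "colluder_strategy c \<theta>" and "symbol_symmetric c \<theta>"
    and "class1 q c (Psi \<theta>) w W"
    and "b \<in> {1..c}"
    and "int N > Max {int c - int b, \<bar>int c - int b * int q\<bar>, (int c - int b) * (int q - 2)}"
  shows "complex_of_real (K q c \<kappa> (Psi \<theta>) b) =
    complex_of_real (fact (c - b) /
      (real N * Gamma (real (c - b) + \<kappa> * real (q - 1)) * gen_Beta (replicate (q - 1) \<kappa>))) *
    (\<Sum>a = 0..N - 1. tau N ^ (a * (c - b)) *
      (\<Sum>l = 0..q - 1. of_nat ((q - 1) choose l) * G c \<kappa> W N b a l ^ (q - 1 - l) *
         complex_of_real (w b l) * v \<kappa> N b a ^ l))"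
proof -
  define n where "n = q - 1"
  define s where "s = c - b"
  \<comment> \<open>\<open>b\<close> is added because \<open>v\<close> contributes it even when
    \<open>b > s\<close>; \<open>A - {b}\<close> is then the range of summation in
    \<open>G\<close>.\<close>
  define A where "A = {0..s} \<union> {b}"
  define L where "L = {x. set x \<subseteq> A \<and> length x = n}"
  define C where "C = fact s / (Gamma (real s + \<kappa> * real n) * gen_Beta (replicate n \<kappa>))"
  \<comment> \<open>The value 1 at \<open>z = b\<close> makes \<open>h a l b\<close> below equal to
    \<open>v\<close>, independently of \<open>l\<close>.\<close>
  define g where "g l z = Gamma (\<kappa> + real z) / fact z * (if z = b then 1 else W b l z)" for l z
  define f where "f x = w b (count_list x b) * prod_list (map (g (count_list x b)) x)" for x
  define h where "h a l z = complex_of_real (g l z) / tau N ^ (a * z)" for a l z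
  have finA: "finite A" and bA: "b \<in> A" by (auto simp: A_def)
  have finL: "finite L" unfolding L_def using finA by (rule finite_lists_length_eq)
  have bc: "b \<le> c" using assms(8) by simp
  have N: "s < N" "int (b * q) - int c < int N" "int s * (int q - 2) < int N"
    using assms(9) bc by (auto simp: s_def)
  have bound: "sum_list x < s + N" if "x \<in> L" for x
  proof -
    have "\<forall>z\<in>set x. z \<le> max s b" using that by (auto simp: L_def A_def)
    then have "sum_list x \<le> length x * max s b"
      by (induction x) auto
    also have "length x = n" using that by (simp add: L_def)
    \<comment> \<open>The last two bounds on \<open>N\<close> enter here, through
      \<open>n * s = s + s * (q - 2)\<close> and \<open>n * b = s + (b * q - c)\<close> over the
      integers.\<close>
    also have "n * max s b < s + N"
    proof -
      have n: "int n = int q - 1" using assms(2) by (simp add: n_def)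
      have "int n * int s < int s + int N" using N(3) unfolding n by (simp add: algebra_simps)
      moreover have "int n * int b < int s + int N"
        using N(2) bc unfolding n by (simp add: s_def algebra_simps)
      ultimately have "int (n * max s b) < int (s + N)" by (auto simp: max_def)
      then show ?thesis by linarith
    qed
    finally show ?thesis .
  qed
  \<comment> \<open>No entry exceeds the sum \<open>s\<close>, so restricting the entries to
    \<open>A\<close> loses no vector.\<close>
  have vec: "vectors n s = {x \<in> L. sum_list x = s}"
    unfolding vectors_def L_def A_def using member_le_sum_list by fastforce
  have Kf: "K q c \<kappa> (Psi \<theta>) b = C * (\<Sum>x\<in>vectors n s. f x)"
    unfolding K_def n_def[symmetric] s_def[symmetric] sum_distrib_left
  proof (rule sum.cong)
    fix x assume "x \<in> vectors n s"
    then have x: "x \<in> vectors (q - 1) (c - b)" by (simp add: n_def s_def)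
    show "vec_prob q c \<kappa> b x * Psi \<theta> b x = C * f x"
      unfolding vec_prob_eq[OF x] class1D[OF assms(7,8) x] f_def g_def prod_list_map_mult
      by (simp add: C_def n_def s_def)
  qed simp
  have prod_h: "prod_list (map (h a l) x) =
      complex_of_real (prod_list (map (g l) x)) / tau N ^ (a * sum_list x)" for a l x
    by (simp add: h_def [abs_def] prod_list_map_divide prod_list_of_real prod_list_power_mult)
  have inner: "(\<Sum>l = 0..n. of_nat (n choose l) * G c \<kappa> W N b a l ^ (n - l) *
      complex_of_real (w b l) * v \<kappa> N b a ^ l) =
      (\<Sum>x\<in>L. complex_of_real (f x) / tau N ^ (a * sum_list x))" for a
  proof -
    have G: "G c \<kappa> W N b a l = sum (h a l) (A - {b})" for l
      unfolding G_def s_def[symmetric] by (rule sum.cong) (auto simp: A_def h_def g_def)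
    have v: "v \<kappa> N b a = h a l b" for l
      by (simp add: v_def h_def g_def)
    have "of_nat (n choose l) * G c \<kappa> W N b a l ^ (n - l) * complex_of_real (w b l) *
        v \<kappa> N b a ^ l =
        (\<Sum>x | x \<in> L \<and> count_list x b = l. complex_of_real (f x) / tau N ^ (a * sum_list x))" for l
    proof -
      have "of_nat (n choose l) * G c \<kappa> W N b a l ^ (n - l) * complex_of_real (w b l) *
          v \<kappa> N b a ^ l =
          complex_of_real (w b l) *
            (\<Sum>x | set x \<subseteq> A \<and> length x = n \<and> count_list x b = l. prod_list (map (h a l) x))"
        unfolding sum_lists_count_eq[OF finA bA] G v[of l] by (simp add: mult_ac)
      also have "\<dots> =
          (\<Sum>x | x \<in> L \<and> count_list x b = l. complex_of_real (f x) / tau N ^ (a * sum_list x))"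
        unfolding sum_distrib_left by (rule sum.cong) (auto simp: L_def f_def prod_h)
      finally show ?thesis .
    qed
    moreover have "count_list x b \<in> {0..n}" if "x \<in> L" for x
      using that count_le_length[of x b] by (auto simp: L_def)
    \<comment> \<open>The sum over \<open>l\<close> collects the fibres of
      \<open>count_list x b\<close> on \<open>L\<close>.\<close>
    ultimately show ?thesis
      using finL by (simp add: sum.group image_subset_iff)
  qed
  have "(\<Sum>a = 0..N - 1. tau N ^ (a * s) *
      (\<Sum>x\<in>L. complex_of_real (f x) / tau N ^ (a * sum_list x))) =
      (\<Sum>a<N. \<Sum>x\<in>L. complex_of_real (f x) * (tau N ^ (a * s) / tau N ^ (a * sum_list x)))"
    using N(1) by (intro sum.cong) (auto simp: sum_distrib_left mult_ac)
  also have "\<dots> = (\<Sum>x\<in>L. complex_of_real (f x) *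
      (\<Sum>a<N. tau N ^ (a * s) / tau N ^ (a * sum_list x)))"
    by (subst sum.swap) (simp add: sum_distrib_left)
  also have "\<dots> = (\<Sum>x\<in>L. if sum_list x = s then complex_of_real (f x) * of_nat N else 0)"
    by (intro sum.cong) (auto simp: sum_tau_powers[OF N(1) bound])
  also have "\<dots> = of_nat N * complex_of_real (\<Sum>x\<in>vectors n s. f x)"
    using finL by (simp add: vec sum.inter_filter sum_distrib_left mult_ac if_distrib cong: if_cong)
  finally have total: "(\<Sum>a = 0..N - 1. tau N ^ (a * s) *
      (\<Sum>x\<in>L. complex_of_real (f x) / tau N ^ (a * sum_list x))) =
      of_nat N * complex_of_real (\<Sum>x\<in>vectors n s. f x)" .
  \<comment> \<open>The factor \<open>N\<close> from the root-of-unity sum cancels the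
    \<open>N\<close> in the denominator of the prefactor.\<close>
  show ?thesis
    unfolding n_def[symmetric] s_def[symmetric] inner total Kf C_def
    using N(1) by simp
qed

end
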